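(* Let $b>0$, let $q:[-b,b]\to\mathbb{C}$ be continuous, and suppose there is a solution $f\in C^2[-b,b]$ of $f''-qf=0$ on $[-b,b]$ with $f(x)\ne0$ for all $x\in[-b,b]$ and $f(0)=1$. Then the system $\{\varphi_k\}_{k=0}^{\infty}$ is complete in $C[-b,b]$, i.e., any continuous (complex-valued) function on $[-b,b]$ can be approximated arbitrarily closely in the uniform norm by a finite linear combination of the functions $\varphi_k$.
   Context: Given $f$, define on $[-b,b]$ the functions $\widetilde X^{(0)}\equiv X^{(0)}\equiv1$ and, for $n\ge1$, $$\widetilde X^{(n)}(x)=n\int_0^x\widetilde X^{(n-1)}(s)\,(f^2(s))^{(-1)^{n-1}}ds,\qquad X^{(n)}(x)=n\int_0^xX^{(n-1)}(s)\,(f^2(s))^{(-1)^{n}}ds,$$ and set $\varphi_k=fX^{(k)}$ for $k$ odd and $\varphi_k=f\widetilde X^{(k)}$ for $k$ even. *)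

theory Defs
  imports "HOL-Analysis.Analysis"
begin

(* The interval integral is oriented: for x < 0 it is minus the integral over [x, 0]. *)

primrec Xtilde :: "(real \<Rightarrow> complex) \<Rightarrow> nat \<Rightarrow> real \<Rightarrow> complex" where
  "Xtilde f 0 = (\<lambda>x. 1)"
| "Xtilde f (Suc n) =
     (\<lambda>x. of_nat (Suc n) * (LBINT s=0..x. Xtilde f n s * ((f s)\<^sup>2) powi ((-1) ^ n)))"

primrec Xplain :: "(real \<Rightarrow> complex) \<Rightarrow> nat \<Rightarrow> real \<Rightarrow> complex" where
  "Xplain f 0 = (\<lambda>x. 1)"
| "Xplain f (Suc n) =
     (\<lambda>x. of_nat (Suc n) * (LBINT s=0..x. Xplain f n s * ((f s)\<^sup>2) powi ((-1) ^ Suc n)))"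

definition phi :: "(real \<Rightarrow> complex) \<Rightarrow> nat \<Rightarrow> real \<Rightarrow> complex" where
  "phi f k x = f x * (if odd k then Xplain f k x else Xtilde f k x)"

(* f is twice continuously differentiable on S with first and second derivatives f' and f'';
   the derivatives are taken within S, hence one-sided at the endpoints of an interval. *)
definition C2_on_with ::
  "real set \<Rightarrow> (real \<Rightarrow> complex) \<Rightarrow> (real \<Rightarrow> complex) \<Rightarrow> (real \<Rightarrow> complex) \<Rightarrow> bool" where
  "C2_on_with S f f' f'' \<longleftrightarrow>
     (\<forall>x\<in>S. (f has_vector_derivative f' x) (at x within S)) \<and>
     (\<forall>x\<in>S. (f' has_vector_derivative f'' x) (at x within S)) \<and>
     continuous_on S f''"

(* Completeness in the space C(S) of continuous complex-valued functions with the uniform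
   norm, for compact S: the functions u k are members of C(S), and their finite complex
   linear combinations are dense. *)
definition complete_system_on :: "real set \<Rightarrow> (nat \<Rightarrow> real \<Rightarrow> complex) \<Rightarrow> bool" where
  "complete_system_on S u \<longleftrightarrow>
     (\<forall>k. continuous_on S (u k)) \<and>
     (\<forall>g. continuous_on S g \<longrightarrow>
        (\<forall>\<epsilon>>0. \<exists>N c. \<forall>x\<in>S. norm (g x - (\<Sum>k\<le>N. c k * u k x)) < \<epsilon>))"

end

theory Submission
  imports Defs "HOL-Computational_Algebra.Formal_Power_Series"
begin

text \<open>
  Let \<open>T\<close> be the linear map from polynomials to functions with \<open>T(x\<^sup>k) = \<phi>\<^sub>k\<close>. Completeness says
  that the range of \<open>T\<close> is dense. The reason is that \<open>T\<close> is the identity plus a Volterra-type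
  operator, so that in the weighted norm \<open>sup e\<^sup>-\<^sup>M\<^sup>|\<^sup>x\<^sup>| |g x|\<close> with \<open>M\<close> large the difference \<open>T - I\<close>
  has norm at most \<open>1/2\<close> (\<open>transmutation_near_identity\<close>). Given \<open>g\<close>, choose a polynomial \<open>p\<close>
  close to \<open>g\<close> by the theorem of Weierstrass; then \<open>g - T p = (g - p) - (T p - p)\<close> is smaller than \<open>g\<close>
  by a fixed factor. Repeating this with \<open>g - T p\<close> in place of \<open>g\<close> gives density
  (\<open>complete_if_near_powers\<close>).

  The bound on \<open>T - I\<close> comes from a wave equation. With \<open>L u = u'' - q u\<close> one has
  \<open>L \<phi>\<^sub>k = k (k - 1) \<phi>\<^sub>k\<^sub>-\<^sub>2\<close>, that is, \<open>T\<close> intertwines the second derivative with \<open>L\<close>. Hence for a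
  polynomial \<open>p\<close> the function \<open>w(x,t) = T[p(\<cdot> + t)](x)\<close> satisfies \<open>w\<^sub>x\<^sub>x - q w = w\<^sub>t\<^sub>t\<close>.
  At \<open>0\<close> the function \<open>\<phi>\<^sub>0 = f\<close> has value \<open>1\<close> and derivative \<open>f'(0)\<close>, \<open>\<phi>\<^sub>1\<close> has value \<open>0\<close> and
  derivative \<open>1\<close>, and the others vanish with their derivatives; so \<open>w = p\<close> and
  \<open>w\<^sub>x = f'(0) p + p'\<close> at \<open>x = 0\<close>, that is, \<open>w\<^sub>x - w\<^sub>t = f'(0) p\<close> there.
  With \<open>a = w\<^sub>x - w\<^sub>t\<close> the equation splits into two ordinary differential equations along characteristics, \<open>(\<partial>\<^sub>x + \<partial>\<^sub>t) a = q w\<close> and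
  \<open>(\<partial>\<^sub>x - \<partial>\<^sub>t) w = a\<close>. No derivative of \<open>p\<close> occurs in them or in the data, so they bound
  \<open>w(x,0) - p(x) = T p (x) - p(x)\<close> by \<open>p\<close> alone (\<open>characteristic_estimate\<close>).

  To avoid binomial sums, all \<open>\<phi>\<^sub>k\<close> are collected in the generating series
  \<open>E(x) = \<Sum> \<phi>\<^sub>k(x) \<lambda>\<^sup>k / k!\<close>, for which the recursion is \<open>E'' = q E + \<lambda>\<^sup>2 E\<close>. The family \<open>w\<close> for
  \<open>p = x\<^sup>k\<close> then has the generating series \<open>e\<^sup>\<lambda>\<^sup>t E(x)\<close>, and the identities for \<open>w\<close> and \<open>a\<close>
  are instances of the product rule.
\<close>

unbundle no vec_syntax
unbundle fps_syntax

section \<open>Formal power series with differentiable coefficients\<close>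

definition fps_deriv_within :: "(real \<Rightarrow> complex fps) \<Rightarrow> complex fps \<Rightarrow> real \<Rightarrow> real set \<Rightarrow> bool" where
  "fps_deriv_within F F' x S \<longleftrightarrow>
     (\<forall>n. ((\<lambda>y. F y $ n) has_vector_derivative F' $ n) (at x within S))"

lemma fps_deriv_within_mult:
  assumes "fps_deriv_within F F' x S" "fps_deriv_within G G' x S"
  shows "fps_deriv_within (\<lambda>y. F y * G y) (F' * G x + F x * G') x S"
  using assms unfolding fps_deriv_within_def fps_mult_nth fps_add_nth
  by (auto simp: add.commute intro!: derivative_eq_intros simp flip: sum.distrib)

lemma fps_deriv_within_exp:
  assumes "(u has_vector_derivative u') (at x within S)"
  shows "fps_deriv_within (\<lambda>y. fps_exp (u y)) (fps_const u' * fps_X * fps_exp (u x)) x S"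
  unfolding fps_deriv_within_def
proof
  fix n
  show "((\<lambda>y. fps_exp (u y) $ n) has_vector_derivative
         (fps_const u' * fps_X * fps_exp (u x)) $ n) (at x within S)"
  proof (cases n)
    case (Suc m)
    have "((\<lambda>z. z ^ Suc m / fact (Suc m)) has_field_derivative u x ^ m / fact m) (at (u x))"
      using of_nat_neq_0[of m, where 'a = complex]
      by (auto intro!: derivative_eq_intros simp: divide_simps simp del: power_Suc of_nat_Suc)
    from field_vector_diff_chain_within[OF assms DERIV_subset[OF this]]
    show ?thesis by (simp add: Suc o_def mult.assoc del: power_Suc of_nat_Suc fact_Suc)
  qed (simp add: mult.assoc)
qed

section \<open>Estimates along characteristics\<close>

text \<open>
  A mean value inequality whose majorant is a combination of exponentials. The two exponentials
  are the two monotone pieces of \<open>e\<^sup>M\<^sup>|\<^sup>s\<^sup>|\<close> along a characteristic; integrating them is what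
  produces the factor \<open>1 / M\<close>.
\<close>
lemma exp_diff_bound:
  fixes F :: "real \<Rightarrow> complex" and A B C M m n :: real
  assumes "0 \<le> x" "M > 0"
    and "\<And>y. y \<in> {0..x} \<Longrightarrow> (F has_vector_derivative F' y) (at y within {0..x})"
    and "\<And>y. y \<in> {0..x} \<Longrightarrow> norm (F' y) \<le> A * exp (M * (m + 2 * y)) + B * exp (M * (n - 2 * y)) + C"
  shows "norm (F x - F 0) \<le> A * (exp (M * (m + 2 * x)) - exp (M * m)) / (2 * M)
           + B * (exp (M * n) - exp (M * (n - 2 * x))) / (2 * M) + C * x"
proof (cases "x = 0")
  case False
  define g where "g y = A * exp (M * (m + 2 * y)) / (2 * M) - B * exp (M * (n - 2 * y)) / (2 * M) + C * y" for y
  have g': "(g has_vector_derivative A * exp (M * (m + 2 * y)) + B * exp (M * (n - 2 * y)) + C) (at y)" for y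
    unfolding g_def has_real_derivative_iff_has_vector_derivative[symmetric]
    using assms(2) by (auto intro!: derivative_eq_intros simp: field_simps)
  have "norm (F x - F 0) \<le> g x - g 0"
  proof (rule differentiable_bound_general)
    show "continuous_on {0..x} F"
      unfolding continuous_on_eq_continuous_within
      using assms(3) has_vector_derivative_continuous by blast
    show "continuous_on {0..x} g" unfolding g_def using assms(2) by (intro continuous_intros) auto
    fix y assume y: "0 < y" "y < x"
    show "(F has_vector_derivative F' y) (at y)"
      using assms(3)[of y] y at_within_interior[of y "{0..x}"] by auto
    show "norm (F' y) \<le> A * exp (M * (m + 2 * y)) + B * exp (M * (n - 2 * y)) + C"
      using assms(4)[of y] y by auto
  qed (use False assms g' in auto)
  then show ?thesis by (simp add: g_def diff_divide_distrib right_diff_distrib)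
qed simp


text \<open>
  Here \<open>a\<close> plays the part of \<open>w\<^sub>x - w\<^sub>t\<close>, and the hypotheses are the equations for \<open>w\<close> and \<open>a\<close>
  along the two families of characteristics in the half diamond \<open>0 \<le> x\<close>, \<open>x + |t| \<le> b\<close>, which
  contains the characteristics from each of its points back to \<open>x = 0\<close>. Let \<open>W\<close> be the maximum of
  \<open>|w| e\<^sup>-\<^sup>M\<^sup>(\<^sup>x\<^sup>+\<^sup>|\<^sup>t\<^sup>|\<^sup>)\<close> on the half diamond. The weight is constant on parts of characteristics, so a
  single integration need not gain \<open>1 / M\<close>; but over the two successive integrations
  each term gains it once. Thus \<open>w(x,t) - p(t + x)\<close> is at most
  \<open>(|h| P + Q b W) / M\<close> times the weight, which at the maximum point forces \<open>W \<le> 2 P\<close> and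
  then gives the claim.
\<close>
lemma characteristic_estimate:
  fixes w a :: "real \<Rightarrow> real \<Rightarrow> complex" and h :: complex and b M P Q :: real
  assumes b: "b > 0" and M: "M > 0" and Q: "Q \<ge> 0" and hQ: "norm h + Q * b \<le> M / 8"
    and w0: "\<And>t. t \<in> {-b..b} \<Longrightarrow> w 0 t = p t"
    and a0: "\<And>t. t \<in> {-b..b} \<Longrightarrow> a 0 t = h * p t"
    and dw: "\<And>r y. y \<in> {0..b} \<Longrightarrow>
               ((\<lambda>y. w y (r - y)) has_vector_derivative a y (r - y)) (at y within {0..b})"
    and da: "\<And>r y. y \<in> {0..b} \<Longrightarrow>
               ((\<lambda>y. a y (r + y)) has_vector_derivative q y * w y (r + y)) (at y within {0..b})"
    and cont: "continuous_on {z. 0 \<le> fst z \<and> fst z + \<bar>snd z\<bar> \<le> b} (\<lambda>z. w (fst z) (snd z))"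
    and q: "\<And>y. y \<in> {0..b} \<Longrightarrow> norm (q y) \<le> Q"
    and p: "\<And>s. s \<in> {-b..b} \<Longrightarrow> norm (p s) \<le> P * exp (M * \<bar>s\<bar>)"
    and x: "x \<in> {0..b}"
  shows "norm (w x 0 - p x) \<le> P / 2 * exp (M * x)"
proof -
  define D where "D = {z::real \<times> real. 0 \<le> fst z \<and> fst z + \<bar>snd z\<bar> \<le> b}"
  have P: "P \<ge> 0" using order_trans[OF norm_ge_zero p[of 0]] b by simp
  have expabs: "exp (M * \<bar>u\<bar>) \<le> exp (M * u) + exp (M * (- u))" for u
    by (cases "u \<ge> 0") auto
  have D_compact: "compact D"
  proof -
    have "D \<subseteq> cbox (0, -b) (b, b)" by (auto simp: D_def)
    then have "bounded D" by (rule bounded_subset[OF bounded_cbox])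
    moreover have "closed D"
      unfolding D_def by (intro closed_Collect_conj closed_Collect_le continuous_intros)
    ultimately show ?thesis by (simp add: compact_eq_bounded_closed)
  qed
  have D_nonempty: "D \<noteq> {}"
    using b by (auto simp: D_def intro!: exI[of _ 0])
  have "\<exists>z\<in>D. \<forall>y\<in>D. norm (w (fst y) (snd y)) * exp (- M * (fst y + \<bar>snd y\<bar>))
              \<le> norm (w (fst z) (snd z)) * exp (- M * (fst z + \<bar>snd z\<bar>))"
    by (rule continuous_attains_sup[OF D_compact])
       (use D_nonempty cont[folded D_def] in \<open>auto intro!: continuous_intros\<close>)
  then obtain z where z: "z \<in> D" and zmax: "\<And>y. y \<in> D \<Longrightarrow>
      norm (w (fst y) (snd y)) * exp (- M * (fst y + \<bar>snd y\<bar>))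
              \<le> norm (w (fst z) (snd z)) * exp (- M * (fst z + \<bar>snd z\<bar>))" by blast
  define W where "W = norm (w (fst z) (snd z)) * exp (- M * (fst z + \<bar>snd z\<bar>))"
  have W0: "W \<ge> 0" by (simp add: W_def)
  have W: "norm (w y s) \<le> W * exp (M * (y + \<bar>s\<bar>))" if "0 \<le> y" "y + \<bar>s\<bar> \<le> b" for y s
  proof -
    have "norm (w y s) * exp (- (M * (y + \<bar>s\<bar>))) \<le> W"
      using zmax[of "(y, s)"] that by (simp add: D_def W_def)
    then show ?thesis by (simp only: exp_minus pos_divide_le_eq[OF exp_gt_zero] flip: divide_inverse)
  qed
  \<comment> \<open>Follow the characteristic through \<open>(x, s)\<close> back to \<open>(0, s - x)\<close>. The weight
      \<open>e\<^sup>M\<^sup>(\<^sup>y\<^sup>+\<^sup>|\<^sup>s\<^sup>-\<^sup>x\<^sup>+\<^sup>y\<^sup>|\<^sup>)\<close> grows on the part where the second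
      coordinate is positive, and is constant where it is negative: only the growing part gains \<open>1 / M\<close> here.\<close>
  have a_bound: "norm (a x s) \<le> norm h * P * (exp (M * (s - x)) + exp (M * (x - s)))
      + Q * W * (exp (M * (s + x)) / (2 * M) + b * exp (M * (x - s)))"
    if x: "0 \<le> x" and s: "x + \<bar>s\<bar> \<le> b" for x s
  proof -
    have "norm (a x ((s - x) + x) - a 0 ((s - x) + 0))
        \<le> Q * W * (exp (M * ((s - x) + 2 * x)) - exp (M * (s - x))) / (2 * M)
           + 0 * (exp (M * 0) - exp (M * (0 - 2 * x))) / (2 * M) + Q * W * exp (M * (x - s)) * x"
    proof (rule exp_diff_bound[OF x M])
      fix y assume y: "y \<in> {0..x}"
      then show "((\<lambda>y. a y (s - x + y)) has_vector_derivative q y * w y (s - x + y)) (at y within {0..x})"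
        using s by (intro has_vector_derivative_within_subset[OF da]) auto
      have "norm (q y * w y (s - x + y)) \<le> Q * (W * exp (M * (y + \<bar>s - x + y\<bar>)))"
        unfolding norm_mult using y s q[of y] Q by (intro mult_mono W) auto
      also have "exp (M * (y + \<bar>s - x + y\<bar>)) \<le> exp (M * (s - x + 2 * y)) + exp (M * (x - s))"
        by (cases "s - x + y \<ge> 0") (auto simp: algebra_simps)
      finally show "norm (q y * w y (s - x + y))
          \<le> Q * W * exp (M * (s - x + 2 * y)) + 0 * exp (M * (0 - 2 * y)) + Q * W * exp (M * (x - s))"
        using Q W0 by (simp add: mult_left_mono distrib_left mult.assoc)
    qed
    also have "\<dots> \<le> Q * W * exp (M * (s + x)) / (2 * M) + Q * W * exp (M * (x - s)) * b"
    proof -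
      have e: "(s - x) + 2 * x = s + x" by simp
      have "Q * W * (exp (M * (s + x)) - exp (M * (s - x))) / (2 * M) \<le> Q * W * exp (M * (s + x)) / (2 * M)"
        using Q W0 M by (intro divide_right_mono mult_left_mono) auto
      moreover have "Q * W * exp (M * (x - s)) * x \<le> Q * W * exp (M * (x - s)) * b"
        using Q W0 s by (intro mult_left_mono) auto
      ultimately show ?thesis unfolding e by simp
    qed
    finally have 1: "norm (a x s - a 0 (s - x))
       \<le> Q * W * exp (M * (s + x)) / (2 * M) + Q * W * exp (M * (x - s)) * b" by simp
    have sx: "s - x \<in> {-b..b}" using x s by auto
    then have "norm (a 0 (s - x)) = norm h * norm (p (s - x))"
      by (simp add: a0 norm_mult)
    also have "\<dots> \<le> norm h * (P * (exp (M * (s - x)) + exp (M * (x - s))))"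
    proof (intro mult_left_mono norm_ge_zero order_trans[OF p[OF sx]] P)
      show "exp (M * \<bar>s - x\<bar>) \<le> exp (M * (s - x)) + exp (M * (x - s))"
        using expabs[of "s - x"] by simp
    qed
    finally have 2: "norm (a 0 (s - x)) \<le> norm h * (P * (exp (M * (s - x)) + exp (M * (x - s))))" .
    have "norm (a x s) \<le> norm (a x s - a 0 (s - x)) + norm (a 0 (s - x))"
      using norm_triangle_sub[of "a x s" "a 0 (s - x)"] by simp
    with 1 2 show ?thesis by (simp add: algebra_simps)
  qed
  \<comment> \<open>Along the other family, \<open>s = t + x - y\<close>, the terms without \<open>1 / M\<close> in the bound for \<open>a\<close>
      become exponentials in \<open>2 y\<close> and gain the factor now; the term that already has it is constant.\<close>
  have w_bound: "norm (w x t - p (t + x)) \<le> (norm h * P + Q * b * W) / M * exp (M * (x + \<bar>t\<bar>))"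
    if x: "0 \<le> x" and t: "x + \<bar>t\<bar> \<le> b" for x t
  proof -
    define A where "A = norm h * P"
    define B where "B = norm h * P + Q * W * b"
    define C where "C = Q * W * exp (M * (t + x)) / (2 * M)"
    have AB: "A \<ge> 0" "B \<ge> 0" using P Q W0 b by (auto simp: A_def B_def)
    have "norm (w x ((t + x) - x) - w 0 ((t + x) - 0))
       \<le> B * (exp (M * (- (t + x) + 2 * x)) - exp (M * (- (t + x)))) / (2 * M)
           + A * (exp (M * (t + x)) - exp (M * (t + x - 2 * x))) / (2 * M) + C * x"
    proof (rule exp_diff_bound[OF x M])
      fix y assume y: "y \<in> {0..x}"
      then show "((\<lambda>y. w y (t + x - y)) has_vector_derivative a y (t + x - y)) (at y within {0..x})"
        using t by (intro has_vector_derivative_within_subset[OF dw]) auto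
      have "norm (a y (t + x - y)) \<le> norm h * P * (exp (M * ((t + x - y) - y)) + exp (M * (y - (t + x - y))))
      + Q * W * (exp (M * ((t + x - y) + y)) / (2 * M) + b * exp (M * (y - (t + x - y))))"
        using y t by (intro a_bound) auto
      also have "\<dots> = B * exp (M * (- (t + x) + 2 * y)) + A * exp (M * (t + x - 2 * y)) + C"
      proof -
        have e: "(t + x - y) - y = t + x - 2 * y" "y - (t + x - y) = - (t + x) + 2 * y" "(t + x - y) + y = t + x"
          by simp_all
        show ?thesis unfolding e A_def B_def C_def by (simp add: distrib_left distrib_right)
      qed
      finally show "norm (a y (t + x - y))
         \<le> B * exp (M * (- (t + x) + 2 * y)) + A * exp (M * (t + x - 2 * y)) + C" .
    qed
    also have "\<dots> \<le> B * exp (M * (x + \<bar>t\<bar>)) / (2 * M) + A * exp (M * (x + \<bar>t\<bar>)) / (2 * M)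
                     + Q * W * exp (M * (x + \<bar>t\<bar>)) / (2 * M) * b"
    proof (intro add_mono divide_right_mono mult_left_mono)
      show "exp (M * (- (t + x) + 2 * x)) - exp (M * (- (t + x))) \<le> exp (M * (x + \<bar>t\<bar>))"
      proof -
        have "exp (M * (- (t + x) + 2 * x)) \<le> exp (M * (x + \<bar>t\<bar>))"
          unfolding exp_le_cancel_iff using M by (intro mult_left_mono) auto
        then show ?thesis using exp_gt_zero[of "M * (- (t + x))"] by linarith
      qed
      show "exp (M * (t + x)) - exp (M * (t + x - 2 * x)) \<le> exp (M * (x + \<bar>t\<bar>))"
      proof -
        have "exp (M * (t + x)) \<le> exp (M * (x + \<bar>t\<bar>))"
          unfolding exp_le_cancel_iff using M by (intro mult_left_mono) auto
        then show ?thesis using exp_gt_zero[of "M * (t + x - 2 * x)"] by linarith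
      qed
      show "C * x \<le> Q * W * exp (M * (x + \<bar>t\<bar>)) / (2 * M) * b"
        unfolding C_def using M Q W0 x t
        by (intro mult_mono divide_right_mono mult_left_mono) auto
    qed (use AB M in auto)
    also have "\<dots> = (norm h * P + Q * b * W) / M * exp (M * (x + \<bar>t\<bar>))"
    proof -
      have "B * g / (2 * M) + A * g / (2 * M) + Q * W * g / (2 * M) * b = (norm h * P + Q * b * W) / M * g" for g
      proof -
        have "B * g / (2 * M) + A * g / (2 * M) + Q * W * g / (2 * M) * b
            = (B * g + A * g + Q * W * g * b) / (2 * M)"
          by (simp only: add_divide_distrib times_divide_eq_left)
        also have "B * g + A * g + Q * W * g * b = 2 * ((norm h * P + Q * b * W) * g)"
          unfolding A_def B_def by algebra
        finally show ?thesis by simp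
      qed
      then show ?thesis .
    qed
    finally have F: "norm (w x ((t + x) - x) - w 0 ((t + x) - 0))
       \<le> (norm h * P + Q * b * W) / M * exp (M * (x + \<bar>t\<bar>))" .
    have "w 0 (t + x) = p (t + x)" using x t by (intro w0) auto
    with F show ?thesis by (simp only: add_diff_cancel_right' diff_0_right)
  qed
  have "W \<le> 2 * P"
  proof -
    let ?x = "fst z" let ?t = "snd z" let ?K = "(norm h * P + Q * b * W) / M"
    have zD: "0 \<le> ?x" "?x + \<bar>?t\<bar> \<le> b" using z by (auto simp: D_def)
    have "norm (w ?x ?t) \<le> norm (w ?x ?t - p (?t + ?x)) + norm (p (?t + ?x))"
      using norm_triangle_sub[of "w ?x ?t" "p (?t + ?x)"] by simp
    also have "\<dots> \<le> ?K * exp (M * (?x + \<bar>?t\<bar>)) + P * exp (M * (?x + \<bar>?t\<bar>))"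
    proof (intro add_mono w_bound[OF zD])
      have tx: "?t + ?x \<in> {-b..b}" using zD by auto
      show "norm (p (?t + ?x)) \<le> P * exp (M * (?x + \<bar>?t\<bar>))"
        using zD M by (intro order_trans[OF p[OF tx]] mult_left_mono P) simp
    qed
    also have "\<dots> = (?K + P) * exp (M * (?x + \<bar>?t\<bar>))" by (simp only: distrib_right)
    finally have "norm (w ?x ?t) \<le> (?K + P) * exp (M * (?x + \<bar>?t\<bar>))" .
    moreover have "W = norm (w ?x ?t) / exp (M * (?x + \<bar>?t\<bar>))"
      unfolding W_def mult_minus_left exp_minus by (simp only: divide_inverse)
    ultimately have "W \<le> ?K + P" by (simp only: pos_divide_le_eq[OF exp_gt_zero])
    then have "M * W \<le> norm h * P + Q * b * W + M * P" using M by (simp add: field_simps)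
    moreover have "norm h * P \<le> M / 8 * P"
      by (rule mult_right_mono[OF order_trans[OF _ hQ] P]) (use Q b in simp)
    moreover have "Q * b * W \<le> M / 8 * W"
      by (rule mult_right_mono[OF order_trans[OF _ hQ] W0]) simp
    ultimately have "M * (7 * W) \<le> M * (9 * P)" by (simp add: algebra_simps)
    then show ?thesis using M P by simp
  qed
  then have "norm h * P + Q * b * W \<le> norm h * P + Q * b * (2 * P)"
    using Q b by (intro add_mono mult_left_mono) auto
  also have "\<dots> \<le> (norm h + Q * b) * P * 2" using P by (simp add: algebra_simps)
  also have "\<dots> \<le> (M / 8) * P * 2" using hQ P by (intro mult_right_mono) auto
  also have "\<dots> \<le> M * (P / 2)" using M P by simp
  finally have "(norm h * P + Q * b * W) / M \<le> P / 2" using M by (simp add: field_simps)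
  then have "(norm h * P + Q * b * W) / M * exp (M * x) \<le> P / 2 * exp (M * x)"
    by (rule mult_right_mono) simp
  moreover have "norm (w x 0 - p x) \<le> (norm h * P + Q * b * W) / M * exp (M * x)"
    using w_bound[of x 0] x by simp
  ultimately show ?thesis by (rule order_trans[rotated])
qed

section \<open>Density from closeness to the powers\<close>

lemma complex_polynomial_function_imp_sum:
  fixes g :: "real \<Rightarrow> complex"
  assumes "polynomial_function g"
  shows "\<exists>N c. \<forall>x. g x = (\<Sum>k\<le>N. c k * of_real x ^ k)"
proof -
  have r: "real_polynomial_function (\<lambda>x. Re (g x))" "real_polynomial_function (\<lambda>x. Im (g x))"
    using assms bounded_linear_Re bounded_linear_Im unfolding polynomial_function_def o_def by auto
  then obtain a m a' m' where
    1: "(\<lambda>x. Re (g x)) = (\<lambda>x. \<Sum>i\<le>m. a i * x ^ i)" "(\<lambda>x. Im (g x)) = (\<lambda>x. \<Sum>i\<le>m'. a' i * x ^ i)"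
    unfolding real_polynomial_function_iff_sum by auto
  define N where "N = max m m'"
  have pad: "(\<Sum>i\<le>k. u i * x ^ i) = (\<Sum>i\<le>N. (if i \<le> k then u i else 0) * x ^ i)"
    if "k \<le> N" for k and u :: "nat \<Rightarrow> real" and x
    using that by (intro sum.mono_neutral_cong_left) auto
  have "g x = (\<Sum>k\<le>N. Complex (if k \<le> m then a k else 0) (if k \<le> m' then a' k else 0) * of_real x ^ k)" for x
  proof -
    have "g x = Complex (\<Sum>i\<le>m. a i * x ^ i) (\<Sum>i\<le>m'. a' i * x ^ i)"
      using 1[THEN fun_cong, of x] by (simp add: complex_eq_iff)
    also have "\<dots> = Complex (\<Sum>i\<le>N. (if i \<le> m then a i else 0) * x ^ i) (\<Sum>i\<le>N. (if i \<le> m' then a' i else 0) * x ^ i)"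
      using pad[of m a x] pad[of m' a' x] by (simp add: N_def)
    also have "\<dots> = (\<Sum>k\<le>N. Complex (if k \<le> m then a k else 0) (if k \<le> m' then a' k else 0) * of_real x ^ k)"
      by (simp add: complex_eq_iff flip: of_real_power)
    finally show ?thesis .
  qed
  then show ?thesis
    by (intro exI[of _ N] exI[of _ "\<lambda>k. Complex (if k \<le> m then a k else 0) (if k \<le> m' then a' k else 0)"]) simp
qed

text \<open>
  Let \<open>T\<close> be the linear map with \<open>T(x\<^sup>k) = u\<^sub>k\<close>. One approximation step replaces \<open>g\<close> by \<open>g - T p\<close> and reduces the weighted norm by the factor
  \<open>3/4\<close>: if \<open>p\<close> is within \<open>G/6\<close> of \<open>g\<close>, then \<open>p\<close> has norm at most \<open>7G/6\<close>, and
  \<open>1/6 + (7/6)/2 = 3/4\<close>. On a bounded interval the weighted norm is equivalent to the uniform one.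
\<close>
lemma complete_if_near_powers:
  fixes b M :: real and u :: "nat \<Rightarrow> real \<Rightarrow> complex"
  assumes M: "M > 0" and u: "\<And>k. continuous_on {-b..b} (u k)"
    and near: "\<forall>c N P.
    (\<forall>s\<in>{-b..b}. norm (\<Sum>k\<le>N. c k * of_real s ^ k) \<le> P * exp (M * \<bar>s\<bar>)) \<longrightarrow>
    (\<forall>x\<in>{-b..b}. norm ((\<Sum>k\<le>N. c k * u k x) - (\<Sum>k\<le>N. c k * of_real x ^ k))
                    \<le> P / 2 * exp (M * \<bar>x\<bar>))"
  shows "complete_system_on {-b..b} u"
proof -
  let ?I = "{-b..b}"
  have step: "\<exists>N c. \<forall>x\<in>?I. norm (g x - (\<Sum>k\<le>N. c k * u k x)) \<le> 3 / 4 * G * exp (M * \<bar>x\<bar>)"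
    if g: "continuous_on ?I g" and G: "G > 0" and gG: "\<forall>x\<in>?I. norm (g x) \<le> G * exp (M * \<bar>x\<bar>)"
    for g :: "real \<Rightarrow> complex" and G
  proof -
    obtain p where "polynomial_function p" and close: "\<forall>x\<in>?I. norm (g x - p x) < G / 6"
      using Stone_Weierstrass_polynomial_function[OF compact_Icc g, of "G / 6"] G by auto
    then obtain N c where p: "\<And>x. p x = (\<Sum>k\<le>N. c k * of_real x ^ k)"
      using complex_polynomial_function_imp_sum by blast
    have one: "1 \<le> exp (M * \<bar>x\<bar>)" for x using M by simp
    have close': "norm (g x - p x) \<le> G / 6 * exp (M * \<bar>x\<bar>)" if "x \<in> ?I" for x
      using close[rule_format, OF that] mult_left_mono[OF one[of x], of "G / 6"] G by linarith
    have "norm (p x) \<le> 7 / 6 * G * exp (M * \<bar>x\<bar>)" if "x \<in> ?I" for x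
      using norm_triangle_sub[of "p x" "g x"] close'[OF that] gG[rule_format, OF that]
      by (simp add: norm_minus_commute)
    then have "\<forall>x\<in>?I. norm ((\<Sum>k\<le>N. c k * u k x) - p x) \<le> 7 / 6 * G / 2 * exp (M * \<bar>x\<bar>)"
      unfolding p by (intro ballI near[rule_format]) auto
    then have "norm (g x - (\<Sum>k\<le>N. c k * u k x)) \<le> 3 / 4 * G * exp (M * \<bar>x\<bar>)" if "x \<in> ?I" for x
      using close'[OF that] that norm_triangle_ineq4[of "g x - p x" "(\<Sum>k\<le>N. c k * u k x) - p x"]
      by fastforce
    then show ?thesis by blast
  qed
  have iterate: "\<exists>N c. \<forall>x\<in>?I. norm (g x - (\<Sum>k\<le>N. c k * u k x)) \<le> (3 / 4) ^ n * G * exp (M * \<bar>x\<bar>)"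
    if g: "continuous_on ?I g" and G: "G > 0" and gG: "\<forall>x\<in>?I. norm (g x) \<le> G * exp (M * \<bar>x\<bar>)"
    for g :: "real \<Rightarrow> complex" and G n
  proof (induction n)
    case 0
    then show ?case using gG by (intro exI[of _ 0] exI[of _ "\<lambda>_. 0"]) simp
  next
    case (Suc n)
    then obtain N c where c: "\<forall>x\<in>?I. norm (g x - (\<Sum>k\<le>N. c k * u k x)) \<le> (3 / 4) ^ n * G * exp (M * \<bar>x\<bar>)"
      by blast
    have "continuous_on ?I (\<lambda>x. g x - (\<Sum>k\<le>N. c k * u k x))" by (intro continuous_intros g u)
    from step[OF this _ c] G obtain N' c' where c': "\<forall>x\<in>?I.
       norm (g x - (\<Sum>k\<le>N. c k * u k x) - (\<Sum>k\<le>N'. c' k * u k x)) \<le> 3 / 4 * ((3 / 4) ^ n * G) * exp (M * \<bar>x\<bar>)"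
      by auto
    define d where "d k = (if k \<le> N then c k else 0) + (if k \<le> N' then c' k else 0)" for k
    have pad: "(\<Sum>k\<le>m. v k * u k x) = (\<Sum>k\<le>max N N'. (if k \<le> m then v k else 0) * u k x)"
      if "m \<le> max N N'" for v :: "nat \<Rightarrow> complex" and m x
      using that by (intro sum.mono_neutral_cong_left) auto
    have "(\<Sum>k\<le>N. c k * u k x) + (\<Sum>k\<le>N'. c' k * u k x) = (\<Sum>k\<le>max N N'. d k * u k x)" for x
      by (simp add: pad[of N] pad[of N'] d_def distrib_right sum.distrib del: if_distrib)
    with c' show ?case
      by (intro exI[of _ "max N N'"] exI[of _ d]) (simp add: diff_diff_eq mult.assoc)
  qed
  show ?thesis
    unfolding complete_system_on_def
  proof (intro conjI allI impI u)
    fix g :: "real \<Rightarrow> complex" and \<epsilon> :: real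
    assume g: "continuous_on ?I g" and \<epsilon>: "\<epsilon> > 0"
    have "bounded (g ` ?I)" by (intro compact_imp_bounded compact_continuous_image g) simp
    then obtain G where G: "G > 0" "\<And>x. x \<in> ?I \<Longrightarrow> norm (g x) \<le> G" unfolding bounded_pos by auto
    have "norm (g x) \<le> G * exp (M * \<bar>x\<bar>)" if "x \<in> ?I" for x
      using G(1) M by (intro order_trans[OF G(2)[OF that]]) simp
    note it = iterate[OF g G(1) ballI[OF this]]
    have "(\<lambda>n. (3 / 4) ^ n * (G * exp (M * b))) \<longlonglongrightarrow> 0"
      by (intro tendsto_mult_left_zero LIMSEQ_power_zero) simp
    then have "\<forall>\<^sub>F n in sequentially. (3 / 4) ^ n * (G * exp (M * b)) < \<epsilon>"
      using \<epsilon> by (rule order_tendstoD(2))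
    then obtain n where n: "(3 / 4) ^ n * (G * exp (M * b)) < \<epsilon>"
      by (metis eventually_sequentially order_refl)
    obtain N c where c: "\<forall>x\<in>?I. norm (g x - (\<Sum>k\<le>N. c k * u k x)) \<le> (3 / 4) ^ n * G * exp (M * \<bar>x\<bar>)"
      using it by blast
    have "norm (g x - (\<Sum>k\<le>N. c k * u k x)) < \<epsilon>" if x: "x \<in> ?I" for x
    proof -
      have "(3 / 4) ^ n * G * exp (M * \<bar>x\<bar>) \<le> (3 / 4) ^ n * G * exp (M * b)"
        using M G(1) x by (intro mult_left_mono) auto
      then show ?thesis using c[rule_format, OF x] n unfolding mult.assoc by linarith
    qed
    then show "\<exists>N c. \<forall>x\<in>?I. norm (g x - (\<Sum>k\<le>N. c k * u k x)) < \<epsilon>" by blast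
  qed
qed

section \<open>The generating series of the system\<close>

text \<open>
  Each integrand is continuous because \<open>f\<close> does not vanish, so the recursion can be differentiated by the fundamental
  theorem; continuity of the preceding function is carried along by induction.
\<close>
lemma Xtilde_Xplain_deriv:
  fixes b :: real
  assumes b: "b > 0" and f: "continuous_on {-b..b} f" and nz: "\<And>x. x \<in> {-b..b} \<Longrightarrow> f x \<noteq> 0"
  shows Xtilde_deriv: "x \<in> {-b..b} \<Longrightarrow> (Xtilde f (Suc n) has_vector_derivative
           of_nat (Suc n) * (Xtilde f n x * ((f x)\<^sup>2) powi ((-1) ^ n))) (at x within {-b..b})"
    and Xplain_deriv: "x \<in> {-b..b} \<Longrightarrow> (Xplain f (Suc n) has_vector_derivative
           of_nat (Suc n) * (Xplain f n x * ((f x)\<^sup>2) powi ((-1) ^ Suc n))) (at x within {-b..b})"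
proof -
  have step: "((\<lambda>x. of_nat k * (LBINT s=0..x. g s * ((f s)\<^sup>2) powi m)) has_vector_derivative
           of_nat k * (g x * ((f x)\<^sup>2) powi m)) (at x within {-b..b})"
    if g: "continuous_on {-b..b} g" and x: "x \<in> {-b..b}" for g :: "real \<Rightarrow> complex" and k :: nat and m x
  proof -
    have "continuous_on {-b..b} (\<lambda>s. g s * ((f s)\<^sup>2) powi m)"
      using nz by (auto intro!: continuous_intros g f)
    then show ?thesis
      using interval_integral_FTC2[of "-b" 0 b _ x] b x
      by (auto intro!: derivative_eq_intros simp: zero_ereal_def)
  qed
  have ct: "continuous_on {-b..b} (Xtilde f n)" for n
  proof (induction n)
    case (Suc n)
    have "\<And>x. x \<in> {-b..b} \<Longrightarrow> (Xtilde f (Suc n) has_vector_derivative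
           of_nat (Suc n) * (Xtilde f n x * ((f x)\<^sup>2) powi ((-1) ^ n))) (at x within {-b..b})"
      using step[OF Suc] by (simp only: Xtilde.simps)
    then show ?case
      unfolding continuous_on_eq_continuous_within using has_vector_derivative_continuous by blast
  qed simp
  have cp: "continuous_on {-b..b} (Xplain f n)" for n
  proof (induction n)
    case (Suc n)
    have "\<And>x. x \<in> {-b..b} \<Longrightarrow> (Xplain f (Suc n) has_vector_derivative
           of_nat (Suc n) * (Xplain f n x * ((f x)\<^sup>2) powi ((-1) ^ Suc n))) (at x within {-b..b})"
      using step[OF Suc] by (simp only: Xplain.simps)
    then show ?case
      unfolding continuous_on_eq_continuous_within using has_vector_derivative_continuous by blast
  qed simp
  show "x \<in> {-b..b} \<Longrightarrow> (Xtilde f (Suc n) has_vector_derivative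
           of_nat (Suc n) * (Xtilde f n x * ((f x)\<^sup>2) powi ((-1) ^ n))) (at x within {-b..b})"
    using step[OF ct] by (simp only: Xtilde.simps)
  show "x \<in> {-b..b} \<Longrightarrow> (Xplain f (Suc n) has_vector_derivative
           of_nat (Suc n) * (Xplain f n x * ((f x)\<^sup>2) powi ((-1) ^ Suc n))) (at x within {-b..b})"
    using step[OF cp] by (simp only: Xplain.simps)
qed

text \<open>
  \<open>\<phi>\<^sub>k\<close> uses \<open>X\<close> for odd \<open>k\<close> and \<open>Xtilde\<close> for even \<open>k\<close>, but the recursion stays within each family.
  Regrouping the two families by parity makes the exponent of \<open>f\<^sup>2\<close> constant: the factors of
  \<open>\<phi>\<^sub>k\<close> are always integrals against \<open>1/f\<^sup>2\<close> of the dual factors, and the dual factors are integrals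
  against \<open>f\<^sup>2\<close> of the factors of \<open>\<phi>\<^sub>k\<close>.
\<close>
definition phi_factor :: "(real \<Rightarrow> complex) \<Rightarrow> nat \<Rightarrow> real \<Rightarrow> complex" where
  "phi_factor f k = (if odd k then Xplain f k else Xtilde f k)"

definition dual_factor :: "(real \<Rightarrow> complex) \<Rightarrow> nat \<Rightarrow> real \<Rightarrow> complex" where
  "dual_factor f k = (if odd k then Xtilde f k else Xplain f k)"

lemma factor_0 [simp]: "phi_factor f 0 = (\<lambda>x. 1)" "dual_factor f 0 = (\<lambda>x. 1)"
  by (simp_all add: phi_factor_def dual_factor_def)

lemma factor_Suc_at_0 [simp]: "phi_factor f (Suc k) 0 = 0" "dual_factor f (Suc k) 0 = 0"
  by (simp_all add: phi_factor_def dual_factor_def zero_ereal_def)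

definition phi_fps :: "(real \<Rightarrow> complex) \<Rightarrow> real \<Rightarrow> complex fps" where
  "phi_fps f x = Abs_fps (\<lambda>k. phi f k x / fact k)"

text \<open>
  This is the derivative of the generating series, with the second \<open>f\<close> cancelled in
  \<open>f (1/f\<^sup>2)\<close>. In this form it is visibly differentiable again, because only \<open>f'\<close>, \<open>1/f\<close>
  and the two kinds of factors occur.
\<close>
definition phi_deriv_fps :: "(real \<Rightarrow> complex) \<Rightarrow> (real \<Rightarrow> complex) \<Rightarrow> real \<Rightarrow> complex fps" where
  "phi_deriv_fps f f' x = Abs_fps (\<lambda>k.
     f' x * (phi_factor f k x / fact k)
       + (case k of 0 \<Rightarrow> 0 | Suc j \<Rightarrow> dual_factor f j x / fact j / f x))"

context
  fixes b :: real and q f f' f'' :: "real \<Rightarrow> complex"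
  assumes b: "b > 0"
    and q: "continuous_on {-b..b} q"
    and f_C2: "C2_on_with {-b..b} f f' f''"
    and ode: "\<And>x. x \<in> {-b..b} \<Longrightarrow> f'' x - q x * f x = 0"
    and nz: "\<And>x. x \<in> {-b..b} \<Longrightarrow> f x \<noteq> 0"
    and f0: "f 0 = 1"
begin

lemma f_deriv:
  assumes "x \<in> {-b..b}"
  shows "(f has_vector_derivative f' x) (at x within {-b..b})"
    and "(f' has_vector_derivative f'' x) (at x within {-b..b})"
  using f_C2 assms by (auto simp: C2_on_with_def)

lemma f_cont: "continuous_on {-b..b} f"
  unfolding continuous_on_eq_continuous_within using f_deriv(1) has_vector_derivative_continuous by blast

lemma factor_deriv:
  assumes x: "x \<in> {-b..b}"
  shows "((\<lambda>y. phi_factor f (Suc k) y / fact (Suc k)) has_vector_derivative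
           dual_factor f k x / fact k / (f x)\<^sup>2) (at x within {-b..b})"
    and "((\<lambda>y. dual_factor f (Suc k) y / fact (Suc k)) has_vector_derivative
           phi_factor f k x / fact k * (f x)\<^sup>2) (at x within {-b..b})"
proof -
  note d = has_vector_derivative_divide[OF Xtilde_deriv[OF b f_cont nz x, of k], where a = "fact (Suc k)"]
           has_vector_derivative_divide[OF Xplain_deriv[OF b f_cont nz x, of k], where a = "fact (Suc k)"]
  have k: "of_nat (Suc k) * (u * v) / fact (Suc k) = u / fact k * (v::complex)" for u v
    using of_nat_neq_0[of k, where 'a = complex] by (simp add: divide_simps del: of_nat_Suc)
  show "((\<lambda>y. phi_factor f (Suc k) y / fact (Suc k)) has_vector_derivative
           dual_factor f k x / fact k / (f x)\<^sup>2) (at x within {-b..b})"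
    and "((\<lambda>y. dual_factor f (Suc k) y / fact (Suc k)) has_vector_derivative
           phi_factor f k x / fact k * (f x)\<^sup>2) (at x within {-b..b})"
    using d unfolding k
    by (auto simp: phi_factor_def dual_factor_def power_int_minus field_simps
          simp del: Xtilde.simps Xplain.simps fact_Suc)
qed

lemma phi_fps_deriv:
  assumes x: "x \<in> {-b..b}"
  shows "fps_deriv_within (phi_fps f) (phi_deriv_fps f f' x) x {-b..b}"
  unfolding fps_deriv_within_def
proof
  fix k
  have eq: "phi_fps f y $ k = f y * (phi_factor f k y / fact k)" for y
    by (simp add: phi_fps_def phi_def phi_factor_def)
  show "((\<lambda>y. phi_fps f y $ k) has_vector_derivative phi_deriv_fps f f' x $ k) (at x within {-b..b})"
  proof (cases k)
    case 0
    show ?thesis unfolding eq using f_deriv(1)[OF x] by (simp add: 0 phi_deriv_fps_def)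
  next
    case (Suc j)
    show ?thesis
      unfolding eq unfolding Suc
      by (rule has_vector_derivative_eq_rhs[OF has_vector_derivative_mult[OF f_deriv(1)[OF x] factor_deriv(1)[OF x]]])
         (use nz[OF x] in \<open>simp add: phi_deriv_fps_def power2_eq_square del: fact_Suc\<close>)
  qed
qed

text \<open>
  Let \<open>U\<close> be the series of the factors and \<open>V\<close> that of the dual factors shifted by one place.
  In \<open>(f' U + V / f)'\<close>, where \<open>U' = V / f\<^sup>2\<close>, the two terms \<open>f' V / f\<^sup>2\<close> cancel. There remains \<open>f'' U = q f U\<close> and
  \<open>V' / f\<close>, which is the series \<open>f U\<close> shifted by two places.
\<close>
lemma phi_deriv_fps_deriv:
  assumes x: "x \<in> {-b..b}"
  shows "fps_deriv_within (phi_deriv_fps f f')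
           (fps_const (q x) * phi_fps f x + fps_X ^ 2 * phi_fps f x) x {-b..b}"
  unfolding fps_deriv_within_def
proof
  fix k
  have f'': "f'' x = q x * f x" using ode[OF x] by simp
  have inv: "((\<lambda>y. inverse (f y)) has_vector_derivative - (f' x / (f x)\<^sup>2)) (at x within {-b..b})"
    using field_vector_diff_chain_within[OF f_deriv(1)[OF x] DERIV_inverse[OF nz[OF x]]]
    by (simp add: o_def power2_eq_square field_simps)
  have eq: "phi_deriv_fps f f' y $ k = f' y * (phi_factor f k y / fact k)
       + (case k of 0 \<Rightarrow> 0 | Suc j \<Rightarrow> (dual_factor f j y / fact j) * inverse (f y))" for y
    by (simp add: phi_deriv_fps_def field_simps split: nat.split)
  have rhs: "(fps_const (q x) * phi_fps f x + fps_X ^ 2 * phi_fps f x) $ k =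
     q x * (f x * (phi_factor f k x / fact k))
       + (if k < 2 then 0 else f x * (phi_factor f (k - 2) x / fact (k - 2)))"
    by (simp add: fps_X_power_mult_nth phi_fps_def phi_def phi_factor_def)
  note d = f_deriv(2)[OF x, unfolded f''] factor_deriv[OF x] inv
  consider "k = 0" | "k = Suc 0" | m where "k = Suc (Suc m)" by (metis not0_implies_Suc)
  then show "((\<lambda>y. phi_deriv_fps f f' y $ k) has_vector_derivative
       (fps_const (q x) * phi_fps f x + fps_X ^ 2 * phi_fps f x) $ k) (at x within {-b..b})"
  proof cases
    case 1
    then show ?thesis unfolding eq rhs using d(1) by simp
  next
    case 2
    have "((\<lambda>y. f' y * (phi_factor f (Suc 0) y / fact (Suc 0)) + inverse (f y)) has_vector_derivative
        q x * (f x * (phi_factor f (Suc 0) x / fact (Suc 0)))) (at x within {-b..b})"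
      by (rule has_vector_derivative_eq_rhs[OF has_vector_derivative_add[OF has_vector_derivative_mult[OF d(1,2)] d(4)]])
         simp
    then show ?thesis unfolding eq rhs unfolding 2 by simp
  next
    case 3
    have "((\<lambda>y. f' y * (phi_factor f k y / fact k)
              + (dual_factor f (Suc m) y / fact (Suc m)) * inverse (f y)) has_vector_derivative
        q x * (f x * (phi_factor f k x / fact k)) + f x * (phi_factor f m x / fact m)) (at x within {-b..b})"
      unfolding 3
      by (rule has_vector_derivative_eq_rhs[OF has_vector_derivative_add
            [OF has_vector_derivative_mult[OF d(1,2)] has_vector_derivative_mult[OF d(3,4)]]])
         (use nz[OF x] in \<open>simp add: power2_eq_square field_simps del: fact_Suc\<close>)
    then show ?thesis unfolding eq rhs unfolding 3 by simp
  qed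
qed

lemma phi_fps_at_0: "phi_fps f 0 = 1"
proof (rule fps_ext)
  fix k
  have "phi_fps f 0 $ k = phi_factor f k 0 / fact k"
    by (simp add: phi_fps_def phi_def phi_factor_def f0)
  then show "phi_fps f 0 $ k = 1 $ k" by (cases k) auto
qed

lemma phi_deriv_fps_at_0: "phi_deriv_fps f f' 0 = fps_const (f' 0) + fps_X"
  by (rule fps_ext) (auto simp: phi_deriv_fps_def f0 fps_X_def gr0_conv_Suc split: nat.split)


section \<open>The transmutation operator is close to the identity\<close>

text \<open>
  The characteristic estimate concerns \<open>x \<ge> 0\<close>; the sign \<open>\<sigma>\<close> reflects \<open>x\<close> and \<open>t\<close> simultaneously
  to cover both halves of the interval at once. The functional \<open>\<Lambda>\<close> below replaces \<open>\<lambda>\<^sup>k / k!\<close> by \<open>c\<^sub>k\<close>, so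
  it sends \<open>e\<^sup>\<lambda>\<^sup>s\<close> to \<open>p(s)\<close> and \<open>E(x)\<close> to \<open>T p (x)\<close>.
\<close>
lemma transmutation_near_identity_half:
  fixes c :: "nat \<Rightarrow> complex" and N :: nat and \<sigma> M P Q :: real
  defines "p \<equiv> \<lambda>s::real. \<Sum>k\<le>N. c k * of_real s ^ k"
  assumes \<sigma>: "\<sigma> = 1 \<or> \<sigma> = -1" and M: "M > 0"
    and Q: "\<And>y. y \<in> {-b..b} \<Longrightarrow> norm (q y) \<le> Q" and hQ: "norm (f' 0) + Q * b \<le> M / 8"
    and p: "\<And>s. s \<in> {-b..b} \<Longrightarrow> norm (p s) \<le> P * exp (M * \<bar>s\<bar>)"
    and x: "x \<in> {0..b}"
  shows "norm ((\<Sum>k\<le>N. c k * phi f k (\<sigma> * x)) - p (\<sigma> * x)) \<le> P / 2 * exp (M * x)"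
proof -
  \<comment> \<open>The factorial undoes the normalization of the generating series.\<close>
  define \<Lambda> where "\<Lambda> F = (\<Sum>k\<le>N. c k * fact k * F $ k)" for F :: "complex fps"
  define \<tau> :: complex where "\<tau> = of_real \<sigma>"
  have \<tau>2: "\<tau> * \<tau> = 1" using \<sigma> by (auto simp: \<tau>_def)
  then have \<tau>2': "fps_const \<tau> * fps_const \<tau> = 1" by simp
  define e :: "real \<Rightarrow> complex fps" where "e t = fps_exp (of_real (\<sigma> * t))" for t
  define E where "E y = phi_fps f (\<sigma> * y)" for y
  define D where "D y = phi_deriv_fps f f' (\<sigma> * y)" for y
  have \<sigma>b: "\<sigma> * y \<in> {-b..b}" if "y \<in> {0..b}" for y using that \<sigma> by auto
  have \<Lambda>_deriv: "((\<lambda>y. \<Lambda> (F y)) has_vector_derivative \<Lambda> F') (at y within S)"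
    if "fps_deriv_within F F' y S" for F F' y S
    using that unfolding \<Lambda>_def fps_deriv_within_def
    by (auto intro!: derivative_eq_intros)
  have chain: "fps_deriv_within (\<lambda>y. F (\<sigma> * y)) (fps_const \<tau> * F') y {0..b}"
    if F: "fps_deriv_within F F' (\<sigma> * y) {-b..b}" for F F' y
    unfolding fps_deriv_within_def
  proof
    fix n
    have "((\<lambda>y. \<sigma> * y) has_vector_derivative \<sigma>) (at y within {0..b})"
      by (auto intro!: derivative_eq_intros)
    moreover have "((\<lambda>y. F y $ n) has_vector_derivative F' $ n) (at (\<sigma> * y) within (\<lambda>y. \<sigma> * y) ` {0..b})"
      using F \<sigma>b by (auto simp: fps_deriv_within_def intro: has_vector_derivative_within_subset)
    ultimately show "((\<lambda>y. F (\<sigma> * y) $ n) has_vector_derivative (fps_const \<tau> * F') $ n) (at y within {0..b})"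
      using vector_diff_chain_within by (fastforce simp: o_def \<tau>_def scaleR_conv_of_real)
  qed
  have E': "fps_deriv_within E (fps_const \<tau> * D y) y {0..b}" if "y \<in> {0..b}" for y
    unfolding E_def D_def by (rule chain[OF phi_fps_deriv[OF \<sigma>b[OF that]]])
  have D': "fps_deriv_within D (fps_const \<tau> * (fps_const (q (\<sigma> * y)) * E y + fps_X ^ 2 * E y)) y {0..b}"
    if "y \<in> {0..b}" for y
    unfolding E_def D_def by (rule chain[OF phi_deriv_fps_deriv[OF \<sigma>b[OF that]]])
  have e'_minus: "fps_deriv_within (\<lambda>y. e (r - y)) (fps_const (- \<tau>) * fps_X * e (r - y)) y {0..b}" for r y
    unfolding e_def \<tau>_def
    by (rule fps_deriv_within_exp) (auto intro!: derivative_eq_intros)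
  have e'_plus: "fps_deriv_within (\<lambda>y. e (r + y)) (fps_const \<tau> * fps_X * e (r + y)) y {0..b}" for r y
    unfolding e_def \<tau>_def
    by (rule fps_deriv_within_exp) (auto intro!: derivative_eq_intros)
  define w where "w y t = \<Lambda> (e t * E y)" for y t
  define a where "a y t = \<Lambda> (fps_const \<tau> * (e t * (D y - fps_X * E y)))" for y t
  have \<Lambda>_exp: "\<Lambda> (e t) = p (\<sigma> * t)" for t
    by (simp add: \<Lambda>_def e_def p_def)
  have \<Lambda>_const: "\<Lambda> (fps_const z * F) = z * \<Lambda> F" for z F
    by (simp add: \<Lambda>_def sum_distrib_left mult_ac)
  have est: "norm (w x 0 - p (\<sigma> * x)) \<le> P / 2 * exp (M * x)"
  proof (rule characteristic_estimate[where w = w and a = a and p = "\<lambda>t. p (\<sigma> * t)" and b = b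
        and h = "\<tau> * f' 0" and Q = Q and q = "\<lambda>y. q (\<sigma> * y)"])
    show "0 \<le> Q" using order_trans[OF norm_ge_zero Q[of 0]] b by simp
    show "norm (\<tau> * f' 0) + Q * b \<le> M / 8" using hQ \<sigma> by (auto simp: norm_mult \<tau>_def)
    show "w 0 t = p (\<sigma> * t)" for t
      by (simp add: w_def E_def phi_fps_at_0 \<Lambda>_exp)
    show "a 0 t = \<tau> * f' 0 * p (\<sigma> * t)" for t
      by (simp add: a_def E_def D_def phi_fps_at_0 phi_deriv_fps_at_0 \<Lambda>_const \<Lambda>_exp mult.commute[of "e t"])
    show "((\<lambda>y. w y (r - y)) has_vector_derivative a y (r - y)) (at y within {0..b})"
      if y: "y \<in> {0..b}" for r y
    proof -
      have "fps_const (- \<tau>) * fps_X * e (r - y) * E y + e (r - y) * (fps_const \<tau> * D y)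
          = fps_const \<tau> * (e (r - y) * (D y - fps_X * E y))"
        unfolding fps_const_neg[symmetric] by algebra
      with \<Lambda>_deriv[OF fps_deriv_within_mult[OF e'_minus E'[OF y]], of r] show ?thesis
        by (simp only: w_def a_def)
    qed
    show "((\<lambda>y. a y (r + y)) has_vector_derivative q (\<sigma> * y) * w y (r + y)) (at y within {0..b})"
      if y: "y \<in> {0..b}" for r y
    proof -
      let ?q = "fps_const (q (\<sigma> * y))"
      have XE: "fps_deriv_within (\<lambda>y. fps_X * E y) (fps_X * (fps_const \<tau> * D y)) y {0..b}"
        using fps_deriv_within_mult[of "\<lambda>_. fps_X" 0, OF _ E'[OF y]] by (simp add: fps_deriv_within_def)
      have DXE: "fps_deriv_within (\<lambda>y. D y - fps_X * E y)
          (fps_const \<tau> * (?q * E y + fps_X ^ 2 * E y) - fps_X * (fps_const \<tau> * D y)) y {0..b}"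
        unfolding fps_deriv_within_def fps_sub_nth
        by (intro allI has_vector_derivative_diff
              D'[OF y, unfolded fps_deriv_within_def, rule_format] XE[unfolded fps_deriv_within_def, rule_format])
      \<comment> \<open>The mixed terms \<open>\<lambda> D\<close> and the terms \<open>\<lambda>\<^sup>2 E\<close> cancel; only the one with \<open>q\<close> is left.\<close>
      have "fps_const \<tau> * (fps_const \<tau> * fps_X * e (r + y) * (D y - fps_X * E y)
              + e (r + y) * (fps_const \<tau> * (?q * E y + fps_X ^ 2 * E y) - fps_X * (fps_const \<tau> * D y)))
          = (fps_const \<tau> * fps_const \<tau>) * (?q * (e (r + y) * E y))"
        by algebra
      also have "\<dots> = ?q * (e (r + y) * E y)" by (simp only: \<tau>2' mult_1)
      finally show ?thesis
        using has_vector_derivative_mult_right[OF \<Lambda>_deriv[OF fps_deriv_within_mult[OF e'_plus DXE]], of \<tau> r]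
        by (simp only: a_def w_def flip: \<Lambda>_const)
    qed
    show "continuous_on {z. 0 \<le> fst z \<and> fst z + \<bar>snd z\<bar> \<le> b} (\<lambda>z. w (fst z) (snd z))"
    proof -
      have "continuous_on {0..b} (\<lambda>y. E y $ n)" for n
        unfolding continuous_on_eq_continuous_within
        using E' has_vector_derivative_continuous unfolding fps_deriv_within_def by blast
      then have "continuous_on {z. 0 \<le> fst z \<and> fst z + \<bar>snd z\<bar> \<le> b} (\<lambda>z::real\<times>real. E (fst z) $ n)" for n
        by (rule continuous_on_compose2) (auto intro: continuous_intros)
      then show ?thesis
        unfolding w_def \<Lambda>_def fps_mult_nth e_def fps_exp_nth by (intro continuous_intros) auto
    qed
    show "norm (q (\<sigma> * y)) \<le> Q" if "y \<in> {0..b}" for y using Q[OF \<sigma>b[OF that]] .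
    show "norm (p (\<sigma> * s)) \<le> P * exp (M * \<bar>s\<bar>)" if "s \<in> {-b..b}" for s
      using p[of "\<sigma> * s"] that \<sigma> by (auto simp: abs_mult)
  qed (use b M x in auto)
  have e0: "e 0 = 1" by (simp add: e_def)
  have wx: "w x 0 = (\<Sum>k\<le>N. c k * phi f k (\<sigma> * x))"
    unfolding w_def e0 \<Lambda>_def E_def phi_fps_def by simp
  show ?thesis using est unfolding wx .
qed

lemma transmutation_near_identity:
  "\<exists>M>0. \<forall>c N P.
    (\<forall>s\<in>{-b..b}. norm (\<Sum>k\<le>N. c k * of_real s ^ k) \<le> P * exp (M * \<bar>s\<bar>)) \<longrightarrow>
    (\<forall>x\<in>{-b..b}. norm ((\<Sum>k\<le>N. c k * phi f k x) - (\<Sum>k\<le>N. c k * of_real x ^ k))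
                    \<le> P / 2 * exp (M * \<bar>x\<bar>))"
proof -
  have "bounded (q ` {-b..b})"
    by (intro compact_imp_bounded compact_continuous_image q) simp
  then obtain Q where Q: "Q > 0" "\<And>y. y \<in> {-b..b} \<Longrightarrow> norm (q y) \<le> Q"
    unfolding bounded_pos by auto
  \<comment> \<open>The smallest weight that \<open>characteristic_estimate\<close> admits.\<close>
  define M where "M = 8 * (norm (f' 0) + Q * b)"
  have M: "M > 0" using Q(1) b by (simp add: M_def add_nonneg_pos)
  show ?thesis
  proof (intro exI[of _ M] conjI M allI impI ballI)
    fix c :: "nat \<Rightarrow> complex" and N P x
    assume "\<forall>s\<in>{-b..b}. norm (\<Sum>k\<le>N. c k * of_real s ^ k) \<le> P * exp (M * \<bar>s\<bar>)"
      and x: "x \<in> {-b..b}"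
    note p = bspec[OF this(1)]
    define \<sigma> :: real where "\<sigma> = (if x \<ge> 0 then 1 else -1)"
    have \<sigma>: "\<sigma> = 1 \<or> \<sigma> = -1" and \<sigma>x: "\<sigma> * \<bar>x\<bar> = x" by (simp_all add: \<sigma>_def)
    have hQ: "norm (f' 0) + Q * b \<le> M / 8" by (simp add: M_def)
    have x': "\<bar>x\<bar> \<in> {0..b}" using x by auto
    show "norm ((\<Sum>k\<le>N. c k * phi f k x) - (\<Sum>k\<le>N. c k * of_real x ^ k)) \<le> P / 2 * exp (M * \<bar>x\<bar>)"
      using transmutation_near_identity_half[where \<sigma> = \<sigma> and x = "\<bar>x\<bar>", OF \<sigma> M Q(2) hQ p x']
      unfolding \<sigma>x .
  qed
qed

lemma phi_continuous: "continuous_on {-b..b} (phi f k)"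
proof -
  have "\<And>x. x \<in> {-b..b} \<Longrightarrow> ((\<lambda>y. phi f k y / fact k) has_vector_derivative
          phi_deriv_fps f f' x $ k) (at x within {-b..b})"
    using phi_fps_deriv by (auto simp: fps_deriv_within_def phi_fps_def)
  then have "continuous_on {-b..b} (\<lambda>y. phi f k y / fact k)"
    unfolding continuous_on_eq_continuous_within using has_vector_derivative_continuous by blast
  then have "continuous_on {-b..b} (\<lambda>y. fact k * (phi f k y / fact k))"
    by (rule continuous_on_mult_left)
  then show ?thesis by simp
qed

lemma phi_complete: "complete_system_on {-b..b} (phi f)"
proof -
  obtain M where "M > 0" and near: "\<forall>c N P.
    (\<forall>s\<in>{-b..b}. norm (\<Sum>k\<le>N. c k * of_real s ^ k) \<le> P * exp (M * \<bar>s\<bar>)) \<longrightarrow>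
    (\<forall>x\<in>{-b..b}. norm ((\<Sum>k\<le>N. c k * phi f k x) - (\<Sum>k\<le>N. c k * of_real x ^ k))
                    \<le> P / 2 * exp (M * \<bar>x\<bar>))"
    using transmutation_near_identity by (elim exE conjE) (rule that)
  from complete_if_near_powers[of M, OF this(1) phi_continuous near] show ?thesis .
qed

end

theorem proposition27:
  fixes b :: real and q f f' f'' :: "real \<Rightarrow> complex"
  assumes "b > 0"
    and "continuous_on {-b..b} q"
    and "C2_on_with {-b..b} f f' f''"
    and "\<And>x. x \<in> {-b..b} \<Longrightarrow> f'' x - q x * f x = 0"
    and "\<And>x. x \<in> {-b..b} \<Longrightarrow> f x \<noteq> 0"
    and "f 0 = 1"
  shows "complete_system_on {-b..b} (phi f)"
  using assms by (rule phi_complete)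

end
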